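(* Consider a two-qubit system with qubits $i$ and $j$ whose pure states $|\psi_i(\theta_i,\phi_i)\rangle$ and $|\psi_j(\theta_j,\phi_j)\rangle$ in $\mathbb{C}^2$ each evolve according to the Schrödinger equation $\frac{d}{dt}|\psi\rangle=-i\mathbf{H}|\psi\rangle$ with a self-adjoint Hamiltonian $\mathbf{H}$. Then there exists a single unitary transformation $\mathbf{U}_{ij}(\mathbf{n}_{ij},\theta_{ij})=e^{-i\frac{\theta_{ij}}{2}\mathbf{n}_{ij}\cdot\vec{\bm{\sigma}}}$, i.e. a rotation by an angle $\theta_{ij}\ge 0$ about a unit axis $\mathbf{n}_{ij}\in\mathbb{R}^3$, such that $$\mathbf{U}_{ij}(\mathbf{n}_{ij},\theta_{ij})|\psi_{i}(\theta_{i},\phi_{i})\rangle=\mathbf{U}_{ij}^{\dagger}(\mathbf{n}_{ij},\theta_{ij})|\psi_{j}(\theta_{j},\phi_{j})\rangle$$ as pure quantum states (i.e. up to a global phase). Furthermore, the minimum time for completing the rotation (the minimum of the completing time over all such single unitary transformations) is $$T=\frac{1}{2}\arccos(\mathbf{s}_{i}\cdot\mathbf{s}_{j}),$$ where $\mathbf{s}_{i}=(\sin\theta_{i}\cos\phi_{i},\sin\theta_{i}\sin\phi_{i},\cos\theta_{i})$ and $\mathbf{s}_{j}=(\sin\theta_{j}\cos\phi_{j},\sin\theta_{j}\sin\phi_{j},\cos\theta_{j})$.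
   Context: The spin-$\frac12$ representation of a qubit with polar angle $\theta_i$ and azimuthal angle $\phi_i$ is $$|\psi_i(\theta_i,\phi_i)\rangle=\begin{pmatrix}e^{-i\phi_i/2}\cos\frac{\theta_i}{2}\\ e^{i\phi_i/2}\sin\frac{\theta_i}{2}\end{pmatrix},$$ and its density matrix is $\bm{\rho}'_i=|\psi_i\rangle\langle\psi_i|=\frac12(\mathbf{I}_2+\mathbf{s}_i\cdot\vec{\bm{\sigma}})$, so pure states correspond to points $\mathbf{s}_i$ on the unit sphere (Bloch sphere). A pure state is identified with its density matrix (its Bloch vector). For $\mathbf{n}\in\mathbb{R}^3$, $\mathbf{n}\cdot\vec{\bm{\sigma}}=n_1\bm{\sigma}_1+n_2\bm{\sigma}_2+n_3\bm{\sigma}_3$ with Pauli matrices $\bm{\sigma}_1=\begin{pmatrix}0&1\\1&0\end{pmatrix}$, $\bm{\sigma}_2=\begin{pmatrix}0&-i\\i&0\end{pmatrix}$, $\bm{\sigma}_3=\begin{pmatrix}1&0\\0&-1\end{pmatrix}$. Time convention: the completing time of the unitary transformation $\mathbf{U}_{ij}(\mathbf{n}_{ij},\theta_{ij})$, applied simultaneously to qubit $i$ (as $\mathbf{U}_{ij}$) and to qubit $j$ (as $\mathbf{U}_{ij}^\dagger$), is its rotation angle $\theta_{ij}$ (rotation at unit angular speed on the Bloch sphere). *)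

theory Defs
  imports "HOL-Analysis.Analysis"
begin

section \<open>Complex matrices\<close>

definition dagger :: "complex^'n^'m \<Rightarrow> complex^'m^'n" where
  "dagger A = (\<chi> i j. cnj (A $ j $ i))"

definition self_adjoint :: "complex^'n^'n \<Rightarrow> bool" where
  "self_adjoint A \<longleftrightarrow> dagger A = A"

definition unitary :: "complex^'n^'n \<Rightarrow> bool" where
  "unitary A \<longleftrightarrow> dagger A ** A = mat 1 \<and> A ** dagger A = mat 1"

definition cscale :: "complex \<Rightarrow> complex^'n^'m \<Rightarrow> complex^'n^'m" where
  "cscale c A = (\<chi> i j. c * A $ i $ j)"

text \<open>The type \<^typ>\<open>complex^'n^'n\<close> carries the componentwise product, so the library's power and
  exponential are not the matrix ones; the definitions below use \<^term>\<open>(**)\<close> instead.\<close>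

primrec mat_power :: "complex^'n^'n \<Rightarrow> nat \<Rightarrow> complex^'n^'n" where
  "mat_power A 0 = mat 1"
| "mat_power A (Suc k) = A ** mat_power A k"

definition mat_exp :: "complex^'n^'n \<Rightarrow> complex^'n^'n" where
  "mat_exp A = (\<Sum>k. mat_power A k /\<^sub>R fact k)"


section \<open>Qubits\<close>

definition psi :: "real \<Rightarrow> real \<Rightarrow> complex^2" where
  "psi \<theta> \<phi> = vector [exp (- \<i> * of_real \<phi> / 2) * of_real (cos (\<theta> / 2)),
                    exp (\<i> * of_real \<phi> / 2) * of_real (sin (\<theta> / 2))]"

definition bloch :: "real \<Rightarrow> real \<Rightarrow> real^3" where
  "bloch \<theta> \<phi> = vector [sin \<theta> * cos \<phi>, sin \<theta> * sin \<phi>, cos \<theta>]"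

definition pauli1 :: "complex^2^2" where
  "pauli1 = vector [vector [0, 1], vector [1, 0]]"

definition pauli2 :: "complex^2^2" where
  "pauli2 = vector [vector [0, - \<i>], vector [\<i>, 0]]"

definition pauli3 :: "complex^2^2" where
  "pauli3 = vector [vector [1, 0], vector [0, - 1]]"

definition dot_pauli :: "real^3 \<Rightarrow> complex^2^2" where
  "dot_pauli n = n $ 1 *\<^sub>R pauli1 + n $ 2 *\<^sub>R pauli2 + n $ 3 *\<^sub>R pauli3"

definition rot :: "real^3 \<Rightarrow> real \<Rightarrow> complex^2^2" where
  "rot n \<theta> = mat_exp (cscale (- \<i> * of_real (\<theta> / 2)) (dot_pauli n))"

text \<open>Equality of pure states: state vectors that differ by a global phase.\<close>

definition same_state :: "complex^2 \<Rightarrow> complex^2 \<Rightarrow> bool" where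
  "same_state x y \<longleftrightarrow> (\<exists>c. norm c = 1 \<and> x = c *s y)"

definition schroedinger :: "complex^2^2 \<Rightarrow> (real \<Rightarrow> complex^2) \<Rightarrow> bool" where
  "schroedinger H \<Psi> \<longleftrightarrow>
     (\<forall>t. (\<Psi> has_vector_derivative (- \<i>) *s (H *v \<Psi> t)) (at t))"


section \<open>Synchronization by a single unitary transformation\<close>

definition synchronizes :: "real^3 \<Rightarrow> real \<Rightarrow> complex^2 \<Rightarrow> complex^2 \<Rightarrow> bool" where
  "synchronizes n \<theta> x y \<longleftrightarrow>
     norm n = 1 \<and> \<theta> \<ge> 0 \<and> same_state (rot n \<theta> *v x) (dagger (rot n \<theta>) *v y)"

text \<open>Both qubits rotate simultaneously and at unit angular speed on the Bloch sphere, so the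
  completing time of a transformation is its rotation angle.\<close>

definition completing_times :: "complex^2 \<Rightarrow> complex^2 \<Rightarrow> real set" where
  "completing_times x y = {\<theta>. \<exists>n. synchronizes n \<theta> x y}"

end

theory Submission
  imports Defs
begin

text \<open>For a unit axis n the matrix N = n.sigma squares to 1, so the rotation by an angle a is
  cos(a/2) - i sin(a/2) N. Rotations about one axis add their angles, so synchronizing x and y
  through U and its adjoint means that the rotation by the doubled angle takes x to y.
  As the expectation <x, N x> is real, that rotation R satisfies |<x, y>| = |<x, R x>| >=
  |cos(a/2)|, while |<x, y>|^2 = (1 + s.s')/2 for the Bloch vectors s, s'; hence a is at least
  arccos(s.s'). For equality, split y, with a suitable phase, as cos(a/2) x - i sin(a/2) w with
  x and w orthonormal, and choose the axis with N x = w.\<close>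

section \<open>Closed form of the rotations\<close>

lemma dot_pauli_nth:
  "dot_pauli n $ 1 $ 1 = of_real (n $ 3)" "dot_pauli n $ 1 $ 2 = of_real (n $ 1) - \<i> * of_real (n $ 2)"
  "dot_pauli n $ 2 $ 1 = of_real (n $ 1) + \<i> * of_real (n $ 2)" "dot_pauli n $ 2 $ 2 = - of_real (n $ 3)"
  by (simp_all add: dot_pauli_def pauli1_def pauli2_def pauli3_def complex_eq_iff)

lemma norm_vec3: "norm (n :: real^3) ^ 2 = (n $ 1)\<^sup>2 + (n $ 2)\<^sup>2 + (n $ 3)\<^sup>2"
  unfolding power2_norm_eq_inner by (simp add: inner_vec_def sum_3 power2_eq_square)

lemma dot_pauli_square:
  assumes "norm n = 1"
  shows "dot_pauli n ** dot_pauli n = mat 1"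
proof -
  have "(n $ 1)\<^sup>2 + (n $ 2)\<^sup>2 + (n $ 3)\<^sup>2 = 1" using assms norm_vec3[of n] by simp
  then show ?thesis
    by (simp add: vec_eq_iff forall_2 matrix_matrix_mult_def sum_2 dot_pauli_nth mat_def
        complex_eq_iff algebra_simps power2_eq_square)
qed

lemma mat_power_cscale_involution:
  assumes "A ** A = mat 1"
  shows "mat_power (cscale c A) k = cscale (c ^ k) (if even k then mat 1 else A)"
proof (induction k)
  case 0
  show ?case by (simp add: cscale_def vec_eq_iff)
next
  case (Suc k)
  have cc: "cscale a B ** cscale b C = cscale (a * b) (B ** C)" for a b and B C :: "complex^'a^'a"
    by (simp add: cscale_def matrix_matrix_mult_def vec_eq_iff sum_distrib_left mult.assoc mult.left_commute)
  show ?case using assms by (simp add: Suc cc)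
qed

text \<open>Even powers of an involution are the identity and odd powers are \<open>A\<close>, so
  the exponential series splits into its even part times \<open>mat 1\<close> and its odd part times
  \<open>A\<close>.\<close>

lemma mat_exp_cscale_involution:
  fixes A :: "complex^'n^'n"
  assumes "A ** A = mat 1"
  shows "mat_exp (cscale c A) = cscale (cosh c) (mat 1) + cscale (sinh c) A"
proof -
  have "(\<lambda>k. (mat_power (cscale c A) k /\<^sub>R fact k) $ i $ j) sums
        ((cscale (cosh c) (mat 1) + cscale (sinh c) A) $ i $ j)" for i j
  proof -
    have e: "(\<lambda>k. c ^ k /\<^sub>R fact k) sums exp c" "(\<lambda>k. (- c) ^ k /\<^sub>R fact k) sums exp (- c)"
      by (rule exp_converges)+
    \<comment> \<open>Half the sum and half the difference of the series at \<open>c\<close> and at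
      \<open>- c\<close> select the even and the odd terms, so convergence follows from the scalar
      exponential alone.\<close>
    have "(\<lambda>k. (c ^ k /\<^sub>R fact k + (- c) ^ k /\<^sub>R fact k) / 2 * mat 1 $ i $ j
             + (c ^ k /\<^sub>R fact k - (- c) ^ k /\<^sub>R fact k) / 2 * A $ i $ j) sums
          ((exp c + exp (- c)) / 2 * mat 1 $ i $ j + (exp c - exp (- c)) / 2 * A $ i $ j)"
      by (intro sums_add sums_mult2 sums_divide sums_diff e)
    moreover have "(mat_power (cscale c A) k /\<^sub>R fact k) $ i $ j =
        (c ^ k /\<^sub>R fact k + (- c) ^ k /\<^sub>R fact k) / 2 * mat 1 $ i $ j
      + (c ^ k /\<^sub>R fact k - (- c) ^ k /\<^sub>R fact k) / 2 * A $ i $ j" for k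
      unfolding mat_power_cscale_involution[OF assms] by (cases "even k") (simp_all add: cscale_def)
    ultimately show ?thesis
      by (simp add: cscale_def cosh_def sinh_def scaleR_conv_of_real)
  qed
  then have "(\<lambda>k. mat_power (cscale c A) k /\<^sub>R fact k) sums (cscale (cosh c) (mat 1) + cscale (sinh c) A)"
    unfolding sums_def by (intro vec_tendstoI) (simp add: sum_component)
  then show ?thesis
    unfolding mat_exp_def by (rule sums_unique[symmetric])
qed

lemma rot_eq:
  assumes "norm n = 1"
  shows "rot n \<theta> = cscale (of_real (cos (\<theta> / 2))) (mat 1)
                 + cscale (- \<i> * of_real (sin (\<theta> / 2))) (dot_pauli n)"
proof -
  have "cosh (- \<i> * of_real (\<theta> / 2)) = of_real (cos (\<theta> / 2))"
       "sinh (- \<i> * of_real (\<theta> / 2)) = - \<i> * of_real (sin (\<theta> / 2))"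
    by (simp_all add: cosh_def sinh_def complex_eq_iff Re_exp Im_exp)
  then show ?thesis
    unfolding rot_def mat_exp_cscale_involution[OF dot_pauli_square[OF assms]] by metis
qed

lemma rot_nth:
  assumes "norm n = 1"
  shows "rot n \<theta> $ 1 $ 1 = Complex (cos (\<theta> / 2)) (- sin (\<theta> / 2) * n $ 3)"
    "rot n \<theta> $ 1 $ 2 = Complex (- sin (\<theta> / 2) * n $ 2) (- sin (\<theta> / 2) * n $ 1)"
    "rot n \<theta> $ 2 $ 1 = Complex (sin (\<theta> / 2) * n $ 2) (- sin (\<theta> / 2) * n $ 1)"
    "rot n \<theta> $ 2 $ 2 = Complex (cos (\<theta> / 2)) (sin (\<theta> / 2) * n $ 3)"
  by (simp_all add: rot_eq[OF assms] cscale_def dot_pauli_nth mat_def complex_eq_iff)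

section \<open>Rotations about a fixed axis as a one-parameter group\<close>

lemma rot_add:
  assumes "norm n = 1"
  shows "rot n a ** rot n b = rot n (a + b)"
proof -
  have n3: "(n $ 3)\<^sup>2 = 1 - (n $ 1)\<^sup>2 - (n $ 2)\<^sup>2" using assms norm_vec3[of n] by simp
  \<comment> \<open>The unit-norm relation once more, for squares that sit inside a longer product
    nested to the right.\<close>
  have n3': "n $ 3 * (n $ 3 * x) = x - (n $ 1)\<^sup>2 * x - (n $ 2)\<^sup>2 * x" for x
    using arg_cong[OF n3, of "\<lambda>z. z * x"] by (simp add: algebra_simps power2_eq_square)
  show ?thesis
    by (simp add: vec_eq_iff forall_2 matrix_matrix_mult_def sum_2 rot_nth[OF assms]
        complex_eq_iff add_divide_distrib cos_add sin_add algebra_simps power2_eq_square n3 n3')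
qed

lemma rot_0:
  assumes "norm n = 1"
  shows "rot n 0 = mat 1"
  by (simp add: vec_eq_iff forall_2 rot_nth[OF assms] mat_def complex_eq_iff)

lemma dagger_rot:
  assumes "norm n = 1"
  shows "dagger (rot n a) = rot n (- a)"
  by (simp add: vec_eq_iff forall_2 rot_nth[OF assms] dagger_def complex_eq_iff)

lemma unitary_rot:
  assumes "norm n = 1"
  shows "unitary (rot n a)"
  by (simp add: unitary_def dagger_rot rot_add rot_0 assms)

text \<open>The adjoint is the inverse rotation, so applying the rotation to both sides moves it all
  to \<open>x\<close> and leaves the phase unchanged. This doubling of the angle is the source of
  the factor 1/2 in the minimum time.\<close>

lemma synchronizes_iff:
  "synchronizes n \<theta> x y \<longleftrightarrow> norm n = 1 \<and> \<theta> \<ge> 0 \<and> same_state (rot n (2 * \<theta>) *v x) y"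
proof (cases "norm n = 1")
  case True
  have inv: "rot n \<theta> *v (rot n (- \<theta>) *v v) = v" "rot n (- \<theta>) *v (rot n \<theta> *v v) = v" for v
    using True by (simp_all add: matrix_vector_mul_assoc rot_add rot_0)
  have dbl: "rot n (2 * \<theta>) *v x = rot n \<theta> *v (rot n \<theta> *v x)"
    using True by (simp add: matrix_vector_mul_assoc rot_add)
  have "rot n \<theta> *v x = c *s (rot n (- \<theta>) *v y) \<longleftrightarrow> rot n (2 * \<theta>) *v x = c *s y" for c
    unfolding dbl by (metis inv vector_scalar_commute)
  then show ?thesis
    using True by (simp add: synchronizes_def same_state_def dagger_rot)
qed (simp add: synchronizes_def)

section \<open>Overlaps of states and Bloch vectors\<close>

text \<open>The Hermitian inner product <x|y>, conjugate-linear in the first argument.\<close>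

definition overlap :: "complex^2 \<Rightarrow> complex^2 \<Rightarrow> complex" where
  "overlap x y = cnj (x $ 1) * y $ 1 + cnj (x $ 2) * y $ 2"

text \<open>The transition probability of two pure states. In sines and cosines of half angles both
  sides are polynomials, equal modulo three Pythagorean relations.\<close>

lemma norm_overlap_psi:
  "(cmod (overlap (psi \<theta> \<phi>) (psi \<theta>' \<phi>')))\<^sup>2 = (1 + bloch \<theta> \<phi> \<bullet> bloch \<theta>' \<phi>') / 2"
proof -
  have p: "psi \<theta> \<phi> $ 1 = Complex (cos (\<phi>/2) * cos (\<theta>/2)) (- sin (\<phi>/2) * cos (\<theta>/2))"
    "psi \<theta> \<phi> $ 2 = Complex (cos (\<phi>/2) * sin (\<theta>/2)) (sin (\<phi>/2) * sin (\<theta>/2))" for \<theta> \<phi>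
    by (simp_all add: psi_def complex_eq_iff Re_exp Im_exp)
  define C S where "C = cos ((\<phi> - \<phi>') / 2)" and "S = sin ((\<phi> - \<phi>') / 2)"
  define c s c' s' where "c = cos (\<theta>/2)" and "s = sin (\<theta>/2)" and "c' = cos (\<theta>'/2)" and "s' = sin (\<theta>'/2)"
  have "overlap (psi \<theta> \<phi>) (psi \<theta>' \<phi>') = Complex (C * (c * c' + s * s')) (S * (c * c' - s * s'))"
    by (simp add: overlap_def p complex_eq_iff C_def S_def c_def s_def c'_def s'_def
        diff_divide_distrib cos_diff sin_diff algebra_simps)
  then have 1: "(cmod (overlap (psi \<theta> \<phi>) (psi \<theta>' \<phi>')))\<^sup>2 = (C * (c * c' + s * s'))\<^sup>2 + (S * (c * c' - s * s'))\<^sup>2"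
    by (simp add: cmod_power2)
  have cosp: "cos (\<phi> - \<phi>') = C\<^sup>2 - S\<^sup>2" 
    unfolding C_def S_def cos_double[symmetric] by (simp only: mult_2 field_sum_of_halves)
  have t: "cos \<theta> = c\<^sup>2 - s\<^sup>2" "sin \<theta> = 2 * s * c" "cos \<theta>' = c'\<^sup>2 - s'\<^sup>2" "sin \<theta>' = 2 * s' * c'"
    using cos_double[of "\<theta>/2"] sin_double[of "\<theta>/2"] cos_double[of "\<theta>'/2"] sin_double[of "\<theta>'/2"]
    by (simp_all add: c_def s_def c'_def s'_def)
  have "bloch \<theta> \<phi> \<bullet> bloch \<theta>' \<phi>' = sin \<theta> * sin \<theta>' * cos (\<phi> - \<phi>') + cos \<theta> * cos \<theta>'"
    by (simp add: bloch_def inner_vec_def sum_3 cos_diff algebra_simps)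
  then have 2: "bloch \<theta> \<phi> \<bullet> bloch \<theta>' \<phi>' = 4 * s * c * s' * c' * (C\<^sup>2 - S\<^sup>2) + (c\<^sup>2 - s\<^sup>2) * (c'\<^sup>2 - s'\<^sup>2)"
    by (simp add: cosp t algebra_simps)
  have "C\<^sup>2 + S\<^sup>2 = 1" "c\<^sup>2 + s\<^sup>2 = 1" "c'\<^sup>2 + s'\<^sup>2 = 1"
    by (simp_all add: C_def S_def c_def s_def c'_def s'_def)
  then have "2 * ((C * (c * c' + s * s'))\<^sup>2 + (S * (c * c' - s * s'))\<^sup>2)
     = 1 + (4 * s * c * s' * c' * (C\<^sup>2 - S\<^sup>2) + (c\<^sup>2 - s\<^sup>2) * (c'\<^sup>2 - s'\<^sup>2))"
    by algebra
  then show ?thesis unfolding 1 2 by simp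
qed

lemma norm_bloch: "norm (bloch \<theta> \<phi>) = 1"
proof -
  have "(sin \<theta> * cos \<phi>)\<^sup>2 + (sin \<theta> * sin \<phi>)\<^sup>2 + (cos \<theta>)\<^sup>2 = 1"
    using sin_cos_squared_add[of \<theta>] sin_cos_squared_add[of \<phi>] by algebra
  then show ?thesis
    using norm_vec3[of "bloch \<theta> \<phi>"] by (simp add: bloch_def norm_eq_1 power2_norm_eq_inner)
qed

lemma inner_bloch_bounds:
  "- 1 \<le> bloch \<theta> \<phi> \<bullet> bloch \<theta>' \<phi>'" "bloch \<theta> \<phi> \<bullet> bloch \<theta>' \<phi>' \<le> 1"
  using Cauchy_Schwarz_ineq2[of "bloch \<theta> \<phi>" "bloch \<theta>' \<phi>'"] by (simp_all add: norm_bloch abs_le_iff)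

lemma overlap_self: "overlap x x = of_real ((cmod (x $ 1))\<^sup>2 + (cmod (x $ 2))\<^sup>2)"
  unfolding cmod_power2 by (simp add: overlap_def complex_eq_iff power2_eq_square)

lemma overlap_psi_self: "overlap (psi \<theta> \<phi>) (psi \<theta> \<phi>) = 1"
proof -
  \<comment> \<open>Equal states give modulus 1; as the overlap of a vector with itself is a
    nonnegative real, it is then 1.\<close>
  have "(cmod (overlap (psi \<theta> \<phi>) (psi \<theta> \<phi>)))\<^sup>2 = 1"
    by (simp add: norm_overlap_psi norm_bloch flip: power2_norm_eq_inner)
  then have "cmod (overlap (psi \<theta> \<phi>) (psi \<theta> \<phi>)) = 1" 
    by (simp add: power2_eq_1_iff) (smt (verit) norm_ge_zero)
  then show ?thesis
    unfolding overlap_self norm_of_real by (simp add: complex_eq_iff)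
qed

section \<open>Lower bound for the angle\<close>

lemma norm_overlap_ge_cos:
  assumes "norm n = 1" and "overlap x x = 1" and "same_state (rot n a *v x) y"
  shows "(cos (a / 2))\<^sup>2 \<le> (cmod (overlap x y))\<^sup>2"
proof -
  from assms(3) obtain c where c: "norm c = 1" "rot n a *v x = c *s y"
    by (auto simp: same_state_def)
  have "overlap x (rot n a *v x) = c * overlap x y"
    unfolding c by (simp add: overlap_def algebra_simps)
  then have "cmod (overlap x (rot n a *v x)) = cmod (overlap x y)"
    using c by (simp add: norm_mult)
  \<comment> \<open>The sine term contributes \<open>- \<i> * sin (a / 2)\<close> times the real
    expectation of \<open>dot_pauli n\<close>, which has no real part.\<close>
  moreover have "Re (overlap x (rot n a *v x)) = cos (a / 2) * Re (overlap x x)"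
    by (simp add: overlap_def matrix_vector_mult_def sum_2 rot_nth[OF assms(1)] algebra_simps)
  ultimately show ?thesis
    using assms(2) by (metis abs_Re_le_cmod mult.right_neutral one_complex.sel(1) power2_abs power_mono abs_ge_zero)
qed

section \<open>An axis that attains the bound\<close>

text \<open>The matrix |w><x| + |x><w| is traceless and self-adjoint, hence of the form
  \<^term>\<open>dot_pauli n\<close>; the norm of its Bloch vector is read off from the image of x.\<close>

lemma dot_pauli_maps_orthonormal:
  assumes "overlap x x = 1" "overlap w w = 1" "overlap x w = 0"
  obtains n where "norm n = 1" and "dot_pauli n *v x = w"
proof -
  \<comment> \<open>The entry (2,1) of |w><x| + |x><w| is to be n1 + i n2, and the entry (1,1) is to
    be n3.\<close>
  define n :: "real^3" where "n = vector [Re (w $ 2 * cnj (x $ 1) + x $ 2 * cnj (w $ 1)),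
     Im (w $ 2 * cnj (x $ 1) + x $ 2 * cnj (w $ 1)), Re (w $ 1 * cnj (x $ 1) + x $ 1 * cnj (w $ 1))]"
  have ii: "of_real (Re z) + \<i> * of_real (Im z) = z" "of_real (Re z) - \<i> * of_real (Im z) = cnj z" for z
    by (simp_all add: complex_eq_iff)
  have r: "of_real (Re (a * cnj b + b * cnj a)) = a * cnj b + b * cnj a" for a b
    by (simp add: complex_eq_iff)
  have "cnj (overlap x w) = 0" using assms by simp
  then have o: "cnj (w $ 1) * x $ 1 + cnj (w $ 2) * x $ 2 = 0" by (simp add: overlap_def algebra_simps)
  have N: "dot_pauli n $ 1 $ 1 = w $ 1 * cnj (x $ 1) + x $ 1 * cnj (w $ 1)"
    "dot_pauli n $ 1 $ 2 = w $ 1 * cnj (x $ 2) + x $ 1 * cnj (w $ 2)"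
    "dot_pauli n $ 2 $ 1 = w $ 2 * cnj (x $ 1) + x $ 2 * cnj (w $ 1)"
    unfolding n_def dot_pauli_nth by (simp_all only: vector_3 ii r) (simp add: algebra_simps)
  \<comment> \<open>The trace of |w><x| + |x><w| is <x|w> + <w|x>, which vanishes by
    orthogonality.\<close>
  have "dot_pauli n $ 2 $ 2 = - dot_pauli n $ 1 $ 1" by (simp add: dot_pauli_nth)
  also have "\<dots> = w $ 2 * cnj (x $ 2) + x $ 2 * cnj (w $ 2)"
    using o assms(3) unfolding N overlap_def by algebra
  finally have N22: "dot_pauli n $ 2 $ 2 = \<dots>" .
  have Nx: "dot_pauli n *v x = w"
    using assms o by (simp add: vec_eq_iff forall_2 matrix_vector_mult_def sum_2 N N22 overlap_def) algebra
  \<comment> \<open>\<open>dot_pauli m\<close> scales lengths by \<open>norm m\<close>; as it maps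
    the unit vector \<open>x\<close> to the unit vector \<open>w\<close> for \<open>m = n\<close>,
    the axis is a unit vector.\<close>
  have "overlap (dot_pauli m *v x) (dot_pauli m *v x) = of_real ((norm m)\<^sup>2) * overlap x x" for m
    unfolding norm_vec3 by (simp add: overlap_def matrix_vector_mult_def sum_2 dot_pauli_nth complex_eq_iff)
      algebra
  from this[of n] have "(norm n)\<^sup>2 = 1"
    using assms unfolding Nx by (simp flip: of_real_power)
  then have "norm n = 1"
    by (simp only: power2_eq_1_iff) (smt (verit) norm_ge_zero)
  with Nx that show thesis by blast
qed

lemma rot_to_state:
  assumes x: "overlap x x = 1" and y: "overlap y y = 1" and a: "cos (a / 2) = cmod (overlap x y)"
  obtains n where "norm n = 1" and "same_state (rot n a *v x) y"
proof -
  \<comment> \<open>the phase that makes the overlap of x with y real and nonnegative\<close>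
  obtain c where c: "cmod c = 1" and cp: "c * overlap x y = of_real (cmod (overlap x y))"
  proof (cases "overlap x y = 0")
    case False
    then have "cnj (sgn (overlap x y)) * overlap x y = of_real (cmod (overlap x y))"
      using complex_norm_square[of "overlap x y"]
      by (simp add: sgn_eq power2_eq_square field_simps)
    with False show thesis
      by (intro that[of "cnj (sgn (overlap x y))"]) (simp_all add: norm_sgn)
  qed (auto intro: that[of 1])
  have cc: "cnj c * c = 1" using c by (metis complex_norm_square mult.commute of_real_1 one_power2)
  define C S where "C = complex_of_real (cos (a / 2))" and "S = complex_of_real (sin (a / 2))"
  have CS: "C\<^sup>2 + S\<^sup>2 = 1" unfolding C_def S_def
    by (metis of_real_1 of_real_add of_real_power sin_cos_squared_add2 add.commute sin_cos_squared_add)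
  have cp: "overlap x (c *s y) = C"
    using cp a by (simp add: overlap_def C_def algebra_simps)
  have cp': "overlap (c *s y) x = C"
    using arg_cong[OF cp, of cnj] by (simp add: overlap_def C_def algebra_simps)
  have yy: "overlap (c *s y) (c *s y) = 1"
    using y cc by (simp add: overlap_def) algebra
  have rx: "rot n a *v x = C *s x - (\<i> * S) *s (dot_pauli n *v x)" if "norm n = 1" for n
    by (simp add: rot_eq[OF that] vec_eq_iff forall_2 matrix_vector_mult_def sum_2 cscale_def mat_def
        C_def S_def algebra_simps)
  have "\<exists>n. norm n = 1 \<and> rot n a *v x = c *s y"
  proof (cases "S = 0")
    case True
    \<comment> \<open>Here \<open>C\<close> squared is 1, so this squared length is zero and
      \<open>c *s y\<close> is already \<open>C *s x\<close>; any unit axis then serves.\<close>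
    have "overlap (c *s y - C *s x) (c *s y - C *s x) = 1 - C * C"
      using x yy cp cp' by (simp add: overlap_def C_def) algebra
    then have "overlap (c *s y - C *s x) (c *s y - C *s x) = 0"
      using True CS by (simp add: power2_eq_square)
    then have "c *s y = C *s x" 
      unfolding overlap_self of_real_eq_0_iff by (simp add: vec_eq_iff forall_2 sum_power2_eq_zero_iff)
    then show ?thesis using True rx by (intro exI[of _ "axis 1 1"]) (simp add: norm_axis_1)
  next
    case False
    \<comment> \<open>solves \<^term>\<open>C *s x - (\<i> * S) *s w = c *s y\<close>\<close>
    define w where "w = (\<i> / S) *s (c *s y - C *s x)"
    have S: "cnj S = S" "cnj C = C" by (simp_all add: S_def C_def)
    \<comment> \<open>\<open>C\<close> is the component of \<open>c *s y\<close> along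
      \<open>x\<close>, so the difference in \<open>w\<close> is orthogonal to
      \<open>x\<close>.\<close>
    have "overlap x w = (\<i> / S) * (overlap x (c *s y) - C * overlap x x)"
      by (simp add: w_def overlap_def algebra_simps)
    then have xw: "overlap x w = 0" using x cp by simp
    \<comment> \<open>The prefactor \<open>\<i> / S\<close> has squared modulus 1 / S^2 because
      \<open>S\<close> is real; the remaining squared length is 1 - C^2 = S^2.\<close>
    have "overlap w w = (overlap (c *s y) (c *s y) - C * overlap (c *s y) x - C * overlap x (c *s y) + C * C * overlap x x) / (S * S)"
      by (simp add: w_def overlap_def S) (simp add: field_simps False)
    also have "\<dots> = (1 - C * C) / (S * S)" unfolding x yy cp cp' by simp
    also have "\<dots> = 1" using CS False by (simp add: field_simps power2_eq_square)
    finally obtain n where n: "norm n = 1" "dot_pauli n *v x = w"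
      using dot_pauli_maps_orthonormal[OF x _ xw] by blast
    have "rot n a *v x = c *s y"
      unfolding rx[OF n(1)] n(2) using False by (simp add: w_def vec_eq_iff algebra_simps)
    with n show ?thesis by blast
  qed
  with c that show thesis unfolding same_state_def by blast
qed

text \<open>The squares agree by the half-angle formula, and the cosine is nonnegative because half
  of an arccos lies between 0 and pi/2. This supplies the angle condition of
  \<open>rot_to_state\<close>.\<close>

lemma cos_half_arccos_bloch:
  "cos (arccos (bloch \<theta> \<phi> \<bullet> bloch \<theta>' \<phi>') / 2) = cmod (overlap (psi \<theta> \<phi>) (psi \<theta>' \<phi>'))"
proof -
  let ?d = "bloch \<theta> \<phi> \<bullet> bloch \<theta>' \<phi>'"
  note d = inner_bloch_bounds[of \<theta> \<phi> \<theta>' \<phi>']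
  have "(cos (arccos ?d / 2))\<^sup>2 = (cmod (overlap (psi \<theta> \<phi>) (psi \<theta>' \<phi>')))\<^sup>2"
    using d cos_double_cos[of "arccos ?d / 2"] by (simp add: norm_overlap_psi cos_arccos)
  moreover have "0 \<le> cos (arccos ?d / 2)"
    using arccos_lbound[OF d] arccos_ubound[OF d] pi_ge_zero
    by (intro cos_ge_zero; linarith)
  ultimately show ?thesis by (simp add: power2_eq_iff_nonneg)
qed

theorem theorem1:
  fixes \<theta>\<^sub>i \<phi>\<^sub>i \<theta>\<^sub>j \<phi>\<^sub>j t\<^sub>0 :: real
    and H\<^sub>i H\<^sub>j :: "complex^2^2"
    and \<Psi>\<^sub>i \<Psi>\<^sub>j :: "real \<Rightarrow> complex^2"
  assumes "self_adjoint H\<^sub>i" and "schroedinger H\<^sub>i \<Psi>\<^sub>i" and "\<Psi>\<^sub>i t\<^sub>0 = psi \<theta>\<^sub>i \<phi>\<^sub>i"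
    and "self_adjoint H\<^sub>j" and "schroedinger H\<^sub>j \<Psi>\<^sub>j" and "\<Psi>\<^sub>j t\<^sub>0 = psi \<theta>\<^sub>j \<phi>\<^sub>j"
  shows "(\<exists>n \<theta>. unitary (rot n \<theta>) \<and> synchronizes n \<theta> (psi \<theta>\<^sub>i \<phi>\<^sub>i) (psi \<theta>\<^sub>j \<phi>\<^sub>j))
    \<and> 1 / 2 * arccos (bloch \<theta>\<^sub>i \<phi>\<^sub>i \<bullet> bloch \<theta>\<^sub>j \<phi>\<^sub>j) \<in> completing_times (psi \<theta>\<^sub>i \<phi>\<^sub>i) (psi \<theta>\<^sub>j \<phi>\<^sub>j)
    \<and> (\<forall>t \<in> completing_times (psi \<theta>\<^sub>i \<phi>\<^sub>i) (psi \<theta>\<^sub>j \<phi>\<^sub>j).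
          1 / 2 * arccos (bloch \<theta>\<^sub>i \<phi>\<^sub>i \<bullet> bloch \<theta>\<^sub>j \<phi>\<^sub>j) \<le> t)"
proof -
  let ?x = "psi \<theta>\<^sub>i \<phi>\<^sub>i" and ?y = "psi \<theta>\<^sub>j \<phi>\<^sub>j" and ?d = "bloch \<theta>\<^sub>i \<phi>\<^sub>i \<bullet> bloch \<theta>\<^sub>j \<phi>\<^sub>j"
  note d = inner_bloch_bounds[of \<theta>\<^sub>i \<phi>\<^sub>i \<theta>\<^sub>j \<phi>\<^sub>j]
  \<comment> \<open>The doubled rotation must cover the whole angle between the Bloch vectors;
    \<open>synchronizes_iff\<close> then halves it.\<close>
  obtain n where "norm n = 1" "same_state (rot n (arccos ?d) *v ?x) ?y"
    by (rule rot_to_state[OF overlap_psi_self overlap_psi_self cos_half_arccos_bloch])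
  then have n: "norm n = 1" "synchronizes n (1 / 2 * arccos ?d) ?x ?y"
    using arccos_lbound[OF d] by (simp_all add: synchronizes_iff)
  moreover have "1 / 2 * arccos ?d \<le> t" if "synchronizes m t ?x ?y" for m t
  proof (cases "2 * t \<le> pi")
    case True
    \<comment> \<open>for angles 2t beyond pi the cosine is not monotone, but there arccos is trivially smaller\<close>
    from that have m: "norm m = 1" "t \<ge> 0" "same_state (rot m (2 * t) *v ?x) ?y"
      by (simp_all add: synchronizes_iff)
    \<comment> \<open>The lower bound is applied to the doubled rotation of angle
      \<open>2 * t\<close>, whose half angle is \<open>t\<close>.\<close>
    have "(cos t)\<^sup>2 \<le> (1 + ?d) / 2"
      using norm_overlap_ge_cos[OF m(1) overlap_psi_self m(3)] by (simp add: norm_overlap_psi)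
    then have "cos (2 * t) \<le> ?d"
      by (simp add: cos_double_cos)
    then have "arccos ?d \<le> arccos (cos (2 * t))"
      using d by (intro arccos_le_arccos) auto
    then show ?thesis using True m by (simp add: arccos_cos)
  next
    case False
    then show ?thesis using arccos_ubound[OF d] by simp
  qed
  ultimately show ?thesis
    unfolding completing_times_def using unitary_rot[OF n(1)] by blast
qed

end
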